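(* Let $m$ be a positive odd integer, let $n$ be a nonnegative integer, let $\mu$ be real with $0\le\mu<1$, and set $\lambda=1-\mu$ (so $\lambda>0$). Then for every real $x$, $$\sum_{k=0}^{m-1}(-1)^{k}\mathfrak{V}_{n}\!\left(\frac{x+k}{m};1-\mu;\mu\right)=\frac{1-m}{m^{n}}\left(\frac{\mu-2}{2(\mu-1)}\right)E_{n}(x)+\frac{1}{m^{n-1}}\mathfrak{V}_{n}(x;1-\mu;\mu).$$
   Context: $E_n(x)$ denotes the classical Euler polynomials, given by $\frac{2}{e^t+1}e^{xt}=\sum_{n\ge0}E_n(x)\frac{t^n}{n!}$. For real $\lambda>0$ and real $\mu\ge0$, $\mu\ne1$, the unified Bernoulli-Euler polynomials of Apostol type are defined by the Taylor expansion at $t=0$ $$\frac{2-\mu+\frac{\mu}{2}t}{\lambda e^{t}+(1-\mu)}e^{xt}=\sum_{n\ge0}\mathfrak{V}_n(x;\lambda;\mu)\frac{t^n}{n!}.$$ *)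

theory Defs
  imports "HOL-Analysis.Analysis"
begin

text \<open>
  Both families are given by their exponential generating functions, read as formal power series
  in \<open>t = fps_X\<close> over the reals; \<open>fps_exp c\<close> is the series of \<open>exp (c * t)\<close>.
\<close>

definition euler_poly :: "nat \<Rightarrow> real \<Rightarrow> real" where
  "euler_poly n x = fact n * fps_nth (fps_const 2 / (fps_exp 1 + 1) * fps_exp x) n"

text \<open>
  Note the order of the arguments of \<open>unified_poly n x l mu\<close>: point, then the two parameters
  (\<open>\<lambda>\<close> and \<open>\<mu>\<close> in the usual notation).
  The definition is meaningful when the quotient has a Taylor expansion at \<open>0\<close>, for instance
  when \<open>l + 1 - mu \<noteq> 0\<close>.
\<close>

definition unified_gf :: "real \<Rightarrow> real \<Rightarrow> real \<Rightarrow> real fps" where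
  "unified_gf x l mu =
     (fps_const (2 - mu) + fps_const (mu / 2) * fps_X)
       / (fps_const l * fps_exp 1 + fps_const (1 - mu)) * fps_exp x"

definition unified_poly :: "nat \<Rightarrow> real \<Rightarrow> real \<Rightarrow> real \<Rightarrow> real" where
  "unified_poly n x l mu = fact n * fps_nth (unified_gf x l mu) n"

text \<open>The formal series are the Taylor expansions at \<open>0\<close> of the generating functions.\<close>

lemma euler_gf_has_fps_expansion:
  "(\<lambda>t. 2 / (exp t + 1) * exp (x * t)) has_fps_expansion
     (fps_const 2 / (fps_exp 1 + 1) * fps_exp (x :: real))"
  by (rule has_fps_expansion_mult has_fps_expansion_divide' has_fps_expansion_const
      has_fps_expansion_add has_fps_expansion_exp1 has_fps_expansion_1 has_fps_expansion_exp | simp)+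

lemma unified_gf_has_fps_expansion:
  assumes "l + 1 - mu \<noteq> 0"
  shows "(\<lambda>t. (2 - mu + mu / 2 * t) / (l * exp t + (1 - mu)) * exp (x * t))
           has_fps_expansion unified_gf x l mu"
  unfolding unified_gf_def
proof (intro has_fps_expansion_mult has_fps_expansion_divide' has_fps_expansion_add
    has_fps_expansion_const has_fps_expansion_fps_X has_fps_expansion_exp1 has_fps_expansion_exp)
  show "fps_nth (fps_const l * fps_exp 1 + fps_const (1 - mu)) 0 \<noteq> 0"
    using assms by simp
qed

end

theory Submission
  imports Defs
begin

text \<open>
  For \<open>\<lambda> = 1 - \<mu>\<close> the denominator of the unified generating function is \<open>(1 - \<mu>) (e\<^sup>t + 1)\<close>, so
  \<open>V\<^sub>n(x) = a E\<^sub>n(x) + b n E\<^sub>n\<^sub>-\<^sub>1(x)\<close> with \<open>a = (\<mu> - 2) / (2 (\<mu> - 1))\<close> and \<open>b = \<mu> / (4 (1 - \<mu>))\<close>.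
  The theorem follows from the multiplication formula of the Euler polynomials of degrees \<open>n\<close> and
  \<open>n - 1\<close>; the term with \<open>1 - m\<close> compensates for the different powers of \<open>m\<close> in the two formulas.
\<close>

lemma fps_exp_plus_1_nonzero: "fps_exp (c :: real) + 1 \<noteq> 0"
proof
  assume "fps_exp c + 1 = 0"
  then have "fps_nth (fps_exp c + 1) 0 = 0"
    by simp
  then show False
    by simp
qed

definition euler_gf :: "real \<Rightarrow> real fps" where
  "euler_gf x = fps_const 2 / (fps_exp 1 + 1) * fps_exp x"

lemma euler_gf_times_denominator: "euler_gf x * (fps_exp 1 + 1) = fps_const 2 * fps_exp x"
proof -
  have "fps_const 2 / (fps_exp (1 :: real) + 1) * (fps_exp 1 + 1) = fps_const 2"
    by (simp add: fps_divide_unit mult.assoc inverse_mult_eq_1)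
  then show ?thesis
    by (simp add: euler_gf_def mult_ac)
qed

lemma euler_poly_eq_euler_gf: "euler_poly n x = fact n * fps_nth (euler_gf x) n"
  by (simp add: euler_poly_def euler_gf_def)

text \<open>The sum telescopes: multiplying a term by \<open>fps_exp c\<close> gives the next
  exponential, which the alternating sign cancels, so only the two end terms survive.\<close>

lemma alternating_sum_fps_exp:
  fixes c x :: real
  shows "(\<Sum>k<m. (-1) ^ k * fps_exp (c * (x + real k))) * (fps_exp c + 1)
         = fps_exp (c * x) - (-1) ^ m * fps_exp (c * (x + real m))"
proof (induction m)
  case (Suc m)
  have *: "fps_exp (c * (x + real (Suc m))) = fps_exp (c * (x + real m)) * fps_exp c"
    by (simp add: fps_exp_add_mult [symmetric] algebra_simps)
  show ?case
    unfolding sum.lessThan_Suc distrib_right[of _ _ "fps_exp c + 1"] Suc.IH *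
    by (simp add: distrib_left)
qed simp

text \<open>Generating-function form of the multiplication formula, the composition being the
  substitution of t/m for t. Both sides agree after multiplication by (e^t + 1)(e^(t/m) + 1), and
  these nonzero factors cancel in the integral domain of power series.\<close>

lemma alternating_sum_euler_gf:
  assumes "odd m"
  shows "(\<Sum>k<m. (-1) ^ k * euler_gf ((x + real k) / real m))
         = euler_gf x oo (fps_const (1 / real m) * fps_X)"
    (is "?S = ?R")
proof -
  define c where "c = 1 / real m"
  have "m > 0"
    using assms by (cases m) auto
  \<comment> \<open>Since c m = 1, the far end of the telescoping sum is
    \<open>fps_exp (c * x) * fps_exp 1\<close>. For odd m its sign is positive, so the two ends
    together contribute the factor e^t + 1.\<close>
  then have c: "c * (x + real m) = c * x + 1"
    by (simp add: c_def field_simps)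
  have "?R * (fps_exp c + 1) = (euler_gf x * (fps_exp 1 + 1)) oo (fps_const c * fps_X)"
    by (simp add: fps_compose_mult_distrib fps_compose_add_distrib c_def)
  also have "\<dots> = fps_const 2 * fps_exp (c * x)"
    by (simp add: euler_gf_times_denominator fps_compose_mult_distrib)
  finally have R: "?R * (fps_exp c + 1) = fps_const 2 * fps_exp (c * x)" .
  have "?S * (fps_exp 1 + 1)
        = (\<Sum>k<m. (-1) ^ k * (euler_gf ((x + real k) / real m) * (fps_exp 1 + 1)))"
    by (simp only: sum_distrib_right mult.assoc)
  also have "\<dots> = fps_const 2 * (\<Sum>k<m. (-1) ^ k * fps_exp (c * (x + real k)))"
    unfolding euler_gf_times_denominator sum_distrib_left
    by (simp add: c_def mult.left_commute)
  finally have "?S * (fps_exp 1 + 1) * (fps_exp c + 1)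
      = fps_const 2 * ((\<Sum>k<m. (-1) ^ k * fps_exp (c * (x + real k))) * (fps_exp c + 1))"
    by (simp only: mult.assoc)
  also have "\<dots> = fps_const 2 * fps_exp (c * x) * (fps_exp 1 + 1)"
    unfolding alternating_sum_fps_exp c
    using assms by (simp add: fps_exp_add_mult distrib_left mult_ac)
  also have "\<dots> = ?R * (fps_exp 1 + 1) * (fps_exp c + 1)"
    by (simp only: R [symmetric] mult_ac)
  finally show ?thesis
    using fps_exp_plus_1_nonzero[of c] fps_exp_plus_1_nonzero[of 1] by simp
qed

text \<open>Comparison of coefficients: substituting t/m for t divides the n-th coefficient by
  m^n.\<close>

lemma euler_poly_multiplication:
  assumes "odd m"
  shows "(\<Sum>k<m. (-1) ^ k * euler_poly n ((x + real k) / real m)) = euler_poly n x / real m ^ n"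
proof -
  \<comment> \<open>The sign on the left is a power series, the one on the right a real
    number.\<close>
  have nth: "fps_nth ((-1) ^ k * f) n = (-1) ^ k * fps_nth f n" for k and f :: "real fps"
    by (cases "even k") auto
  have "fps_nth (\<Sum>k<m. (-1) ^ k * euler_gf ((x + real k) / real m)) n
        = fps_nth (euler_gf x) n / real m ^ n"
    by (simp add: alternating_sum_euler_gf[OF assms] fps_compose_linear power_divide)
  then show ?thesis
    by (simp add: euler_poly_eq_euler_gf fps_sum_nth nth sum_distrib_left [symmetric]
        mult.left_commute)
qed

text \<open>Both sides yield N e^(xt) when multiplied by (1 - \<mu>) D, which is nonzero for \<mu>
  \<noteq> 1.\<close>

lemma unified_gf_eq_euler_gf:
  assumes "\<mu> \<noteq> 1"
  shows "unified_gf x (1 - \<mu>) \<mu> = fps_const ((\<mu> - 2) / (2 * (\<mu> - 1))) * euler_gf x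
           + fps_const (\<mu> / (4 * (1 - \<mu>))) * (fps_X * euler_gf x)"
    (is "_ = fps_const ?a * _ + fps_const ?b * _")
proof -
  define D :: "real fps" where "D = fps_exp 1 + 1"
  define N where "N = fps_const (2 - \<mu>) + fps_const (\<mu> / 2) * fps_X"
  have "D \<noteq> 0"
    using fps_exp_plus_1_nonzero unfolding D_def .
  have "fps_nth D 0 \<noteq> 0"
    by (simp add: D_def)
  have den: "fps_const (1 - \<mu>) * fps_exp 1 + fps_const (1 - \<mu>) = fps_const (1 - \<mu>) * D"
    by (simp add: D_def algebra_simps)
  have "N / (fps_const (1 - \<mu>) * D) * (fps_const (1 - \<mu>) * D) = N"
    using assms \<open>fps_nth D 0 \<noteq> 0\<close>
    by (simp add: fps_divide_unit mult.assoc inverse_mult_eq_1 del: fps_const_sub)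
  moreover have "unified_gf x (1 - \<mu>) \<mu> = N / (fps_const (1 - \<mu>) * D) * fps_exp x"
    unfolding unified_gf_def den N_def ..
  moreover have "c * (q * e * D) = q * (c * D) * e" for c q e :: "real fps"
    by (simp only: mult_ac)
  ultimately have "fps_const (1 - \<mu>) * (unified_gf x (1 - \<mu>) \<mu> * D) = N * fps_exp x"
    by (simp only:)
  moreover have "fps_const (1 - \<mu>) * ((fps_const ?a * euler_gf x
      + fps_const ?b * (fps_X * euler_gf x)) * D) = N * fps_exp x"
  proof -
    \<comment> \<open>The constants are the two coefficients of \<open>N\<close> divided by 2 (1 -
      \<mu>), where the 2 is the numerator in \<open>euler_gf\<close>.\<close>
    have a: "(1 - \<mu>) * (?a * 2) = 2 - \<mu>" and b: "(1 - \<mu>) * (?b * 2) = \<mu> / 2"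
      using assms by (simp_all add: divide_simps) (simp_all add: algebra_simps)
    have "fps_const (1 - \<mu>) * ((fps_const ?a * euler_gf x
        + fps_const ?b * (fps_X * euler_gf x)) * D)
      = fps_const (1 - \<mu>) * (fps_const ?a + fps_const ?b * fps_X) * (euler_gf x * D)"
      by (simp only: algebra_simps)
    also have "\<dots> = (fps_const ((1 - \<mu>) * (?a * 2)) + fps_const ((1 - \<mu>) * (?b * 2)) * fps_X)
        * fps_exp x"
      unfolding euler_gf_times_denominator[folded D_def] fps_const_mult [symmetric]
      by (simp only: distrib_left distrib_right mult_ac)
    finally show ?thesis
      unfolding a b N_def .
  qed
  ultimately have "fps_const (1 - \<mu>) * (unified_gf x (1 - \<mu>) \<mu> * D)
      = fps_const (1 - \<mu>) * ((fps_const ?a * euler_gf x + fps_const ?b * (fps_X * euler_gf x)) * D)"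
    by simp
  then show ?thesis
    using assms \<open>D \<noteq> 0\<close> by (simp only: mult_cancel_left mult_cancel_right) simp
qed

text \<open>For \<open>n = 0\<close> the truncated index \<open>n - 1\<close> is harmless because of the factor \<open>n\<close>.\<close>

lemma unified_poly_eq_euler_poly:
  assumes "\<mu> \<noteq> 1"
  shows "unified_poly n x (1 - \<mu>) \<mu> = (\<mu> - 2) / (2 * (\<mu> - 1)) * euler_poly n x
           + \<mu> / (4 * (1 - \<mu>)) * real n * euler_poly (n - 1) x"
proof (cases n)
  case 0
  then show ?thesis
    by (simp add: unified_poly_def unified_gf_eq_euler_gf[OF assms] euler_poly_eq_euler_gf)
next
  \<comment> \<open>The factor \<open>fps_X\<close> shifts the coefficient index by one, and n! = n
    (n - 1)! supplies the factor n.\<close>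
  case (Suc l)
  then show ?thesis
    by (simp add: unified_poly_def unified_gf_eq_euler_gf[OF assms] euler_poly_eq_euler_gf
        distrib_left mult_ac del: of_nat_Suc)
qed

theorem theorem3:
  fixes m n :: nat and \<mu> x :: real
  assumes "odd m" and "0 \<le> \<mu>" and "\<mu> < 1"
  shows "(\<Sum>k = 0..m - 1. (-1) ^ k * unified_poly n ((x + real k) / real m) (1 - \<mu>) \<mu>) =
         (1 - real m) / real m ^ n * ((\<mu> - 2) / (2 * (\<mu> - 1))) * euler_poly n x
         + 1 / real m powi (int n - 1) * unified_poly n x (1 - \<mu>) \<mu>"
proof -
  define a b where "a = (\<mu> - 2) / (2 * (\<mu> - 1))" and "b = \<mu> / (4 * (1 - \<mu>)) * real n"
  have "m > 0"
    using assms(1) by (cases m) auto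
  then have m: "{0..m - 1} = {..<m}"
    by auto
  \<comment> \<open>The exponent is an integer, so for n = 0 the value is m.\<close>
  have powi: "1 / real m powi (int n - 1) = real m / real m ^ n"
    using \<open>m > 0\<close> by (simp add: power_int_diff)
  \<comment> \<open>Here \<open>n - 1\<close> is truncated; for n = 0 both sides vanish because
    \<open>b\<close> contains the factor n.\<close>
  have pred: "b * e / real m ^ (n - 1) = b * e * real m / real m ^ n" for e
    using \<open>m > 0\<close> by (cases n) (simp_all add: b_def)
  have V: "unified_poly n y (1 - \<mu>) \<mu> = a * euler_poly n y + b * euler_poly (n - 1) y" for y
    using assms unified_poly_eq_euler_poly[of \<mu> n y] by (simp add: a_def b_def)
  have "(\<Sum>k<m. (-1) ^ k * unified_poly n ((x + real k) / real m) (1 - \<mu>) \<mu>)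
      = a * (\<Sum>k<m. (-1) ^ k * euler_poly n ((x + real k) / real m))
        + b * (\<Sum>k<m. (-1) ^ k * euler_poly (n - 1) ((x + real k) / real m))"
    by (simp add: V sum_distrib_left sum.distrib [symmetric] algebra_simps)
  also have "\<dots> = a * euler_poly n x / real m ^ n
      + b * euler_poly (n - 1) x * real m / real m ^ n"
    by (simp add: euler_poly_multiplication[OF assms(1)] pred[unfolded One_nat_def])
  also have "\<dots> = (1 - real m) / real m ^ n * a * euler_poly n x
      + real m / real m ^ n * unified_poly n x (1 - \<mu>) \<mu>"
    using \<open>m > 0\<close> by (simp add: V field_simps)
  finally show ?thesis
    unfolding m powi a_def .
qed

end
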